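(* Let $n\ge 1$ and let $P(2n+1,1)$ be the graph with vertex set $\{u_0,\dots,u_{2n},v_0,\dots,v_{2n}\}$ and edge set $\{u_iu_{i+1}\}\cup\{v_iv_{i+1}\}\cup\{u_iv_i\}$, $i=0,\dots,2n$, indices modulo $2n+1$. Then for every $l$ with $2\le l\le 2n+1$, the number of cycles of length $2l$ in $P(2n+1,1)$ is $2n+1$, and the number of cycles of length $2n+1$ in $P(2n+1,1)$ is $2$.
   Context: Cycles are counted as subgraphs. *)

theory Defs
  imports Main
begin

text \<open>A graph is a pair of a vertex set and a set of edges, an undirected edge between
  \<open>x\<close> and \<open>y\<close> being the set \<open>{x, y}\<close>.\<close>

type_synonym 'a ugraph = "'a set \<times> 'a set set"

abbreviation verts :: "'a ugraph \<Rightarrow> 'a set" where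
  "verts G \<equiv> fst G"

abbreviation edges :: "'a ugraph \<Rightarrow> 'a set set" where
  "edges G \<equiv> snd G"

definition simple_graph :: "'a ugraph \<Rightarrow> bool" where
  "simple_graph G \<longleftrightarrow> (\<forall>e \<in> edges G. e \<subseteq> verts G \<and> card e = 2)"

definition subgraph :: "'a ugraph \<Rightarrow> 'a ugraph \<Rightarrow> bool" where
  "subgraph H G \<longleftrightarrow> simple_graph H \<and> verts H \<subseteq> verts G \<and> edges H \<subseteq> edges G"

definition cycle_graph :: "nat \<Rightarrow> 'a ugraph \<Rightarrow> bool" where
  "cycle_graph k C \<longleftrightarrow> k \<ge> 3 \<and>
     (\<exists>ws. distinct ws \<and> length ws = k \<and> verts C = set ws \<and>
           edges C = {{ws ! i, ws ! ((i + 1) mod k)} | i. i < k})"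

text \<open>Cycles are counted as subgraphs: the choice of a starting vertex or of an orientation
  does not matter.\<close>

definition num_cycles :: "'a ugraph \<Rightarrow> nat \<Rightarrow> nat" where
  "num_cycles G k = card {C. subgraph C G \<and> cycle_graph k C}"

datatype gp_vertex = U nat | V nat

definition gen_petersen :: "nat \<Rightarrow> nat \<Rightarrow> gp_vertex ugraph" where
  "gen_petersen m k =
     (U ` {..<m} \<union> V ` {..<m},
      {{U i, U ((i + 1) mod m)} | i. i < m} \<union>
      {{V i, V ((i + k) mod m)} | i. i < m} \<union>
      {{U i, V i} | i. i < m})"

text \<open>\<open>num_cycles\<close> takes the cardinality of a finite set here, and the graphs in question
  are simple.\<close>

lemma finite_cycles:
  assumes "finite (verts G)" "finite (edges G)"
  shows "finite {C. subgraph C G \<and> cycle_graph k C}"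
  by (rule finite_subset[of _ "Pow (verts G) \<times> Pow (edges G)"])
     (use assms in \<open>auto simp: subgraph_def\<close>)

lemma finite_gen_petersen:
  "finite (verts (gen_petersen m k))" "finite (edges (gen_petersen m k))"
  by (auto simp: gen_petersen_def)

lemma simple_gen_petersen_1:
  assumes "m \<ge> 2"
  shows "simple_graph (gen_petersen m 1)"
proof -
  have "i \<noteq> Suc i mod m" if "i < m" for i
    using that assms by (cases "Suc i = m") auto
  then show ?thesis
    using assms by (auto simp: simple_graph_def gen_petersen_def card_2_iff)
qed

end

theory Submission
  imports Defs
begin

text \<open>Let \<open>a j\<close>, \<open>b j\<close>, \<open>r j\<close> say whether the cycle contains the \<open>j\<close>-th edge of the \<open>u\<close>-rim, of the
  \<open>v\<close>-rim, and the \<open>j\<close>-th rung. Even degrees force \<open>r (j + 1)\<close> to be the exclusive or of \<open>a j\<close>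
  and \<open>a (j + 1)\<close>, and likewise for \<open>b\<close>, so whether \<open>a\<close> and \<open>b\<close> agree does not depend on the
  position. If they disagree, the cycle winds around the prism and has length \<open>m\<close> plus an even
  number of rungs; this is odd for odd \<open>m\<close>, and equal to \<open>m\<close> only for the two rims. If they agree,
  connectedness leaves a single run of positions where both hold, so the cycle is the boundary of
  a ladder of \<open>l\<close> consecutive rungs; it has length \<open>2 l\<close>, and there are \<open>m\<close> choices of its first rung.\<close>

section \<open>Cycles as periodic vertex sequences\<close>

text \<open>A closed walk through \<open>k\<close> distinct vertices, extended with period
  \<open>k\<close> to all naturals, so that successors need no wrap-around case.\<close>

definition cyclic_seq :: "nat \<Rightarrow> (nat \<Rightarrow> 'a) \<Rightarrow> bool" where
  "cyclic_seq k w \<longleftrightarrow> (\<forall>i j. w i = w j \<longleftrightarrow> i mod k = j mod k)"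

lemma cyclic_seq_eq_iff: "cyclic_seq k w \<Longrightarrow> w i = w j \<longleftrightarrow> i mod k = j mod k"
  by (simp add: cyclic_seq_def)

lemma mod_Suc_cancel:
  fixes i j k :: nat
  shows "Suc i mod k = Suc j mod k \<longleftrightarrow> i mod k = j mod k"
proof (induction i j rule: linorder_wlog)
  case (le i j)
  then have "(Suc j mod k = Suc i mod k) = (j mod k = i mod k)"
    by (simp add: mod_eq_dvd_iff_nat)
  then show ?case by metis
qed metis

lemma mod_add_neq:
  fixes i d k :: nat
  assumes "0 < d" "d < k"
  shows "(i + d) mod k \<noteq> i mod k"
  using assms mod_eq_dvd_iff_nat[of i "i + d" k] by (auto dest: dvd_imp_le)

text \<open>Equal edges could only differ by their orientation, and then \<open>j\<close> and
  \<open>j + 2\<close> would be congruent modulo \<open>k\<close>, which \<open>3 \<le> k\<close>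
  excludes.\<close>

lemma cyclic_edge_eq_iff:
  assumes w: "cyclic_seq k w" and k: "3 \<le> k"
  shows "{w i, w (Suc i)} = {w j, w (Suc j)} \<longleftrightarrow> i mod k = j mod k"
proof -
  have False if "i mod k = Suc j mod k" "Suc i mod k = j mod k"
  proof -
    have "Suc i mod k = (j + 2) mod k"
      using that(1) mod_Suc_cancel[of i k "Suc j"] by simp
    with that(2) mod_add_neq[of 2 k j] k show False by simp
  qed
  then show ?thesis
    using w mod_Suc_cancel[of i k j]
    by (auto simp: doubleton_eq_iff cyclic_seq_eq_iff)
qed

lemma atLeastLessThan_shift: "{i..<i + s} = (\<lambda>t. i + t) ` {..<s}" for i s :: nat
  using image_add_atLeastLessThan[of i 0 s] by (simp add: lessThan_atLeast0 add.commute)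

lemma range_periodic:
  fixes f :: "nat \<Rightarrow> 'a"
  assumes "\<And>j. f (j mod k) = f j" "0 < k"
  shows "range f = f ` {..<k}"
proof -
  have "f j \<in> f ` {..<k}" for j
    using assms by (metis imageI lessThan_iff mod_less_divisor)
  then show ?thesis by auto
qed

lemma cycle_graphE:
  assumes "cycle_graph k C"
  obtains w where "3 \<le> k" "cyclic_seq k w" "verts C = range w"
    "edges C = range (\<lambda>i. {w i, w (Suc i)})"
proof -
  from assms obtain ws where k: "3 \<le> k" and d: "distinct ws" and len: "length ws = k"
    and vC: "verts C = set ws"
    and eC: "edges C = {{ws ! i, ws ! ((i + 1) mod k)} | i. i < k}"
    by (auto simp: cycle_graph_def)
  define w where "w i = ws ! (i mod k)" for i
  have "cyclic_seq k w"
    using d len k by (auto simp: cyclic_seq_def w_def nth_eq_iff_index_eq)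
  moreover have "verts C = w ` {..<k}"
    unfolding vC using len by (auto simp: w_def set_conv_nth)
  then have "verts C = range w"
    using k by (subst range_periodic[where k = k]) (auto simp: w_def)
  moreover have "edges C = (\<lambda>i. {w i, w (Suc i)}) ` {..<k}"
    unfolding eC by (auto simp: w_def)
  then have "edges C = range (\<lambda>i. {w i, w (Suc i)})"
    using k by (subst range_periodic[where k = k]) (auto simp: w_def mod_Suc_eq)
  ultimately show thesis
    using that k by blast
qed

text \<open>An introduction rule for closed walks given piecewise on one period, such as the
  boundary of a ladder, where a periodic formula would be awkward.\<close>

lemma cycle_graphI:
  assumes "3 \<le> k" "inj_on w {..<k}" "verts C = w ` {..<k}"
    "edges C = (\<lambda>i. {w i, w (if Suc i = k then 0 else Suc i)}) ` {..<k}"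
  shows "cycle_graph k C"
proof -
  have "map w [0..<k] ! i = w i \<and>
      map w [0..<k] ! ((i + 1) mod k) = w (if Suc i = k then 0 else Suc i)" if "i < k" for i
    using that by (auto simp: mod_Suc)
  then have "edges C = {{map w [0..<k] ! i, map w [0..<k] ! ((i + 1) mod k)} | i. i < k}"
    unfolding assms(4) setcompr_eq_image lessThan_def
    by (intro image_cong) (simp_all del: One_nat_def)
  then show ?thesis
    unfolding cycle_graph_def using assms
    by (intro conjI exI[of _ "map w [0..<k]"])
       (auto simp: distinct_map atLeast0LessThan)
qed

lemma cycle_graph_cyclicI:
  assumes "3 \<le> k" "cyclic_seq k w" "verts C = range w"
    "edges C = range (\<lambda>i. {w i, w (Suc i)})"
  shows "cycle_graph k C"
proof (rule cycle_graphI)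
  show "inj_on w {..<k}"
    using assms(2) by (auto simp: inj_on_def cyclic_seq_eq_iff)
  have per: "w (j mod k) = w j" "w (Suc (j mod k)) = w (Suc j)" for j
    using assms(2) by (auto simp: cyclic_seq_eq_iff mod_Suc_eq)
  show "verts C = w ` {..<k}"
    unfolding assms(3) using assms(1) per by (intro range_periodic) auto
  have "w (if Suc i = k then 0 else Suc i) = w (Suc i)" for i
    using assms(2) by (auto simp: cyclic_seq_eq_iff)
  then show "edges C = (\<lambda>i. {w i, w (if Suc i = k then 0 else Suc i)}) ` {..<k}"
    unfolding assms(4) using assms(1) per by (subst range_periodic[where k = k]) auto
qed (use assms in auto)

text \<open>Makes the length a function of the graph, so that two descriptions of one cycle can be
  compared by length.\<close>

lemma cycle_graph_card_edges:
  assumes "cycle_graph k C"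
  shows "card (edges C) = k"
proof -
  from assms obtain w where k: "3 \<le> k" and w: "cyclic_seq k w"
    and eC: "edges C = range (\<lambda>i. {w i, w (Suc i)})"
    by (rule cycle_graphE)
  have "edges C = (\<lambda>i. {w i, w (Suc i)}) ` {..<k}"
    unfolding eC using k w
    by (intro range_periodic) (auto simp: cyclic_edge_eq_iff)
  moreover have "inj_on (\<lambda>i. {w i, w (Suc i)}) {..<k}"
    using k w by (auto simp: inj_on_def cyclic_edge_eq_iff simp del: insert_iff)
  ultimately show ?thesis by (simp add: card_image)
qed

text \<open>A cycle has no isolated vertices, so it is determined by its edge set.\<close>

lemma cycle_graph_verts:
  assumes "cycle_graph k C"
  shows "verts C = \<Union> (edges C)"
proof -
  from assms obtain w where "verts C = range w"
    and "edges C = range (\<lambda>i. {w i, w (Suc i)})"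
    by (rule cycle_graphE)
  then show ?thesis by auto
qed

text \<open>The edges at \<open>w (Suc i)\<close> are those with indices \<open>i\<close> and
  \<open>Suc i\<close> modulo \<open>k\<close>, and these are distinct.\<close>

lemma cycle_graph_degree:
  assumes "cycle_graph k C"
  shows "card {e \<in> edges C. x \<in> e} = 0 \<or> card {e \<in> edges C. x \<in> e} = 2"
proof (cases "x \<in> verts C")
  case False
  then have "{e \<in> edges C. x \<in> e} = {}"
    using cycle_graph_verts[OF assms] by auto
  then show ?thesis by (metis card.empty)
next
  case True
  from assms obtain w where k: "3 \<le> k" and w: "cyclic_seq k w" and vC: "verts C = range w"
    and eC: "edges C = range (\<lambda>i. {w i, w (Suc i)})"
    by (rule cycle_graphE)
  from True vC obtain j where "x = w j" by auto
  \<comment> \<open>Adding a full period gives \<open>x\<close> an index of the form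
    \<open>Suc i\<close>, so that its predecessor on the cycle is \<open>w i\<close>.\<close>
  then have x: "x = w (Suc (j + k - 1))"
    using w k by (simp add: cyclic_seq_eq_iff)
  define i where "i = j + k - 1"
  have "{e \<in> edges C. x \<in> e} = {{w i, w (Suc i)}, {w (Suc i), w (Suc (Suc i))}}"
  proof (intro equalityI subsetI)
    fix e assume "e \<in> {e \<in> edges C. x \<in> e}"
    then obtain t where e: "e = {w t, w (Suc t)}" and "x = w t \<or> x = w (Suc t)"
      using eC by auto
    then have "Suc i mod k = t mod k \<or> i mod k = t mod k"
      using x w mod_Suc_cancel[of i k t] by (auto simp: i_def cyclic_seq_eq_iff)
    then show "e \<in> {{w i, w (Suc i)}, {w (Suc i), w (Suc (Suc i))}}"
      unfolding e using cyclic_edge_eq_iff[OF w k] by (metis insertCI)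
  qed (use x eC in \<open>auto simp: i_def\<close>)
  moreover have "{w i, w (Suc i)} \<noteq> {w (Suc i), w (Suc (Suc i))}"
    using cyclic_edge_eq_iff[OF w k, of i "Suc i"] mod_add_neq[of 1 k i] k by auto
  ultimately show ?thesis by simp
qed

text \<open>A set that no edge of the cycle leaves is never left when walking along the cycle from
  \<open>x\<close>.\<close>

lemma cycle_graph_connected:
  assumes "cycle_graph k C" "x \<in> verts C" "x \<in> S"
    and closed: "\<And>e. e \<in> edges C \<Longrightarrow> e \<inter> S \<noteq> {} \<Longrightarrow> e \<subseteq> S"
  shows "verts C \<subseteq> S"
proof -
  from assms(1) obtain w where k: "3 \<le> k" and w: "cyclic_seq k w" and vC: "verts C = range w"
    and eC: "edges C = range (\<lambda>i. {w i, w (Suc i)})"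
    by (rule cycle_graphE)
  from assms(2) vC obtain i where i: "x = w i" by auto
  have *: "w (i + t) \<in> S" for t
  proof (induction t)
    case (Suc t)
    then show ?case using closed[of "{w (i + t), w (Suc (i + t))}"] eC by auto
  qed (use assms(3) i in auto)
  have "w j \<in> S" for j
  proof -
    \<comment> \<open>The walk only goes forward from \<open>i\<close>, so \<open>j\<close> is first
      raised by a multiple of the period.\<close>
    have "i \<le> j + i * k" using k by (simp add: trans_le_add2)
    then have "w (j + i * k) \<in> S" using *[of "j + i * k - i"] by simp
    then show ?thesis using w by (metis cyclic_seq_eq_iff mod_mult_self1)
  qed
  then show ?thesis using vC by auto
qed

text \<open>Each change flips the truth value, so the parity of the number of changes compares the
  two ends.\<close>

lemma even_card_changes:
  fixes a :: "nat \<Rightarrow> bool"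
  shows "even (\<Sum>j<n. of_bool (a j \<noteq> a (Suc j)) :: nat) \<longleftrightarrow> a 0 = a n"
  by (induction n) auto

section \<open>The prism\<close>

locale prism =
  fixes m :: nat
  assumes m3: "3 \<le> m"
begin

text \<open>The reduction modulo \<open>m\<close> is built into the names, so that edges can be
  indexed by all naturals with a plain \<open>Suc\<close>.\<close>

definition u :: "nat \<Rightarrow> gp_vertex" where "u j = U (j mod m)"
definition v :: "nat \<Rightarrow> gp_vertex" where "v j = V (j mod m)"

abbreviation uu :: "nat \<Rightarrow> gp_vertex set" where "uu j \<equiv> {u j, u (Suc j)}"
abbreviation vv :: "nat \<Rightarrow> gp_vertex set" where "vv j \<equiv> {v j, v (Suc j)}"
abbreviation uv :: "nat \<Rightarrow> gp_vertex set" where "uv j \<equiv> {u j, v j}"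

definition P :: "gp_vertex ugraph" where "P = gen_petersen m 1"

lemma cyclic_u: "cyclic_seq m u" and cyclic_v: "cyclic_seq m v"
  by (auto simp: cyclic_seq_def u_def v_def)

lemma u_eq_iff: "u i = u j \<longleftrightarrow> i mod m = j mod m"
  and v_eq_iff: "v i = v j \<longleftrightarrow> i mod m = j mod m"
  and u_neq_v: "u i \<noteq> v j" "v j \<noteq> u i"
  by (auto simp: u_def v_def)

lemma uu_eq_iff: "uu i = uu j \<longleftrightarrow> i mod m = j mod m"
  and vv_eq_iff: "vv i = vv j \<longleftrightarrow> i mod m = j mod m"
  and uv_eq_iff: "uv i = uv j \<longleftrightarrow> i mod m = j mod m"
  using cyclic_edge_eq_iff[OF cyclic_u m3] cyclic_edge_eq_iff[OF cyclic_v m3]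
  by (auto simp: doubleton_eq_iff u_eq_iff v_eq_iff u_neq_v)

lemma edge_kinds_neq:
  "uu i \<noteq> vv j" "uu i \<noteq> uv j" "vv i \<noteq> uv j"
  "vv j \<noteq> uu i" "uv j \<noteq> uu i" "uv j \<noteq> vv i"
  by (auto simp: doubleton_eq_iff u_neq_v)

lemma verts_P: "verts P = range u \<union> range v"
proof -
  have "U ` {..<m} = u ` {..<m}" "V ` {..<m} = v ` {..<m}"
    by (auto simp: u_def v_def)
  moreover have "range u = u ` {..<m}" "range v = v ` {..<m}"
    by (rule range_periodic; use m3 in \<open>simp add: u_def v_def\<close>)+
  ultimately show ?thesis by (simp add: P_def gen_petersen_def)
qed

lemma edges_P: "edges P = range uu \<union> range vv \<union> range uv"
proof -
  have "range uu = uu ` {..<m}" "range vv = vv ` {..<m}" "range uv = uv ` {..<m}"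
    by (rule range_periodic; use m3 in \<open>simp add: u_def v_def mod_Suc_eq\<close>)+
  moreover have "uu ` {..<m} = {{U i, U ((i + 1) mod m)} | i. i < m}"
    "vv ` {..<m} = {{V i, V ((i + 1) mod m)} | i. i < m}"
    "uv ` {..<m} = {{U i, V i} | i. i < m}"
    by (auto simp: u_def v_def image_def)+
  ultimately show ?thesis by (simp add: P_def gen_petersen_def)
qed

lemma subgraph_P:
  assumes "verts C \<subseteq> verts P" "edges C \<subseteq> edges P" "\<And>e. e \<in> edges C \<Longrightarrow> e \<subseteq> verts C"
  shows "subgraph C P"
  using assms simple_gen_petersen_1[of m] m3
  by (auto simp: P_def subgraph_def simple_graph_def)

text \<open>Facts stated at \<open>Suc j\<close>, where the predecessor is simply \<open>j\<close>,
  thereby reach every position, including \<open>0\<close>.\<close>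

lemma Suc_surj_mod: "\<exists>j. i mod m = Suc j mod m"
  using m3 by (intro exI[of _ "i + m - 1"]) simp

section \<open>Ladders and rims as cycles of the prism\<close>

text \<open>Only the boundary of the strip over the rungs \<open>i\<close> to
  \<open>i + l - 1\<close>: the inner rungs are left out, and each side has \<open>l - 1\<close> rim
  edges. Indices may run past \<open>m\<close>.\<close>

definition ladder :: "nat \<Rightarrow> nat \<Rightarrow> gp_vertex ugraph" where
  "ladder i l = (u ` {i..<i + l} \<union> v ` {i..<i + l},
     uu ` {i..<i + l - 1} \<union> vv ` {i..<i + l - 1} \<union> {uv i, uv (i + l - 1)})"

text \<open>Brings the first rung below \<open>m\<close>, so that \<open>m\<close> starting
  positions cover all ladders.\<close>

lemma ladder_mod:
  assumes "0 < l"
  shows "ladder (i mod m) l = ladder i l"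
proof -
  have shift: "f ` {i..<i + s} = f ` {i mod m..<i mod m + s}"
    if "\<And>j. f (j mod m) = f j" for f :: "nat \<Rightarrow> 'x" and s
  proof -
    have "f ` {j..<j + s} = (\<lambda>t. f (j + t)) ` {..<s}" for j
      by (simp add: atLeastLessThan_shift image_image)
    moreover have "f (i mod m + t) = f (i + t)" for t
      using that by (metis mod_add_left_eq)
    ultimately show ?thesis by simp
  qed
  have "u (i mod m + s) = u (i + s)" "v (i mod m + s) = v (i + s)" for s
    by (auto simp: u_def v_def mod_add_left_eq)
  from this[of 0] this[of "l - 1"] show ?thesis
    unfolding ladder_def
    using shift[of u l] shift[of v l] shift[of uu "l - 1"] shift[of vv "l - 1"]
    using assms by (cases l) (auto simp: u_def v_def mod_Suc_eq)
qed

lemma cyclic_inj_window: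
  assumes w: "cyclic_seq m w" and l: "l \<le> m"
  shows "inj_on w {i..<i + l}"
proof (rule linorder_inj_onI)
  fix x y assume "x < y" "x \<in> {i..<i + l}" "y \<in> {i..<i + l}"
  then have "0 < y - x" "y - x < m" "y = x + (y - x)" using l by auto
  then have "y mod m \<noteq> x mod m" by (metis mod_add_neq)
  then show "w x \<noteq> w y" using w by (auto simp: cyclic_seq_eq_iff)
qed auto

text \<open>The boundary is traversed along the \<open>u\<close>-side upwards and back along the
  \<open>v\<close>-side; \<open>l \<le> m\<close> keeps the vertices distinct.\<close>

lemma cycle_graph_ladder:
  assumes "2 \<le> l" "l \<le> m"
  shows "cycle_graph (2 * l) (ladder i l)"
proof (rule cycle_graphI)
  \<comment> \<open>At \<open>t = l\<close> the second branch starts at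
    \<open>v (i + l - 1)\<close>, opposite the last \<open>u\<close>, and at
    \<open>t = 2 * l - 1\<close> it ends at \<open>v i\<close>.\<close>
  define w where "w t = (if t < l then u (i + t) else v (i + (2 * l - 1 - t)))" for t
  have inj: "u (i + s) = u (i + t) \<longleftrightarrow> s = t" "v (i + s) = v (i + t) \<longleftrightarrow> s = t"
    if "s < l" "t < l" for s t
    using that assms inj_on_eq_iff[OF cyclic_inj_window[OF cyclic_u assms(2), of i], of "i + s" "i + t"]
      inj_on_eq_iff[OF cyclic_inj_window[OF cyclic_v assms(2), of i], of "i + s" "i + t"] by auto
  show "inj_on w {..<2 * l}"
  proof (rule inj_onI)
    fix x y assume "x \<in> {..<2 * l}" "y \<in> {..<2 * l}" "w x = w y"
    then show "x = y"
      using inj(1)[of x y] inj(2)[of "2 * l - 1 - x" "2 * l - 1 - y"]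
      by (auto simp: w_def u_neq_v split: if_splits)
  qed
  have split: "{..<2 * l} = {..<l} \<union> (\<lambda>t. 2 * l - 1 - t) ` {..<l}"
  proof -
    have "x \<in> (\<lambda>t. 2 * l - 1 - t) ` {..<l}" if "l \<le> x" "x < 2 * l" for x
      using that by (intro image_eqI[of _ _ "2 * l - 1 - x"]) auto
    then show ?thesis by (auto simp: not_less[symmetric])
  qed
  note win = atLeastLessThan_shift[of i]
  have wv: "w (2 * l - 1 - t) = v (i + t)" if "t < l" for t
    using that by (auto simp: w_def)
  show "verts (ladder i l) = w ` {..<2 * l}"
    unfolding split image_Un image_image ladder_def win
    using wv by (auto simp: w_def)
  \<comment> \<open>Each half contributes \<open>l - 1\<close> rim edges and one rung. The rung is
    split off at \<open>t = l - 1\<close> on the way up, and at reversed index \<open>0\<close> on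
    the way back.\<close>
  have lt: "{..<l} = insert (l - 1) {..<l - 1}" "{..<l} = insert 0 (Suc ` {..<l - 1})"
    using assms lessThan_Suc[of "l - 1"] lessThan_Suc_eq_insert_0[of "l - 1"] by simp_all
  let ?e = "\<lambda>t. {w t, w (if Suc t = 2 * l then 0 else Suc t)}"
  have "?e ` {..<l} = uu ` {i..<i + l - 1} \<union> {uv (i + l - 1)}"
  proof -
    have "?e t = uu (i + t)" if "t < l - 1" for t
      using that by (auto simp: w_def)
    moreover have "?e (l - 1) = uv (i + l - 1)"
      using assms by (auto simp: w_def)
    ultimately show ?thesis
      unfolding lt(1) using win[of "l - 1"] assms by (simp add: image_image)
  qed
  moreover have "?e ` (\<lambda>t. 2 * l - 1 - t) ` {..<l} = vv ` {i..<i + l - 1} \<union> {uv i}"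
  proof -
    have "?e (2 * l - 1 - Suc t) = vv (i + t)" if "t < l - 1" for t
      using that wv[of t] wv[of "Suc t"] by (auto simp: Suc_diff_Suc)
    moreover have "?e (2 * l - 1 - 0) = uv i"
      using assms by (auto simp: w_def)
    ultimately show ?thesis
      unfolding lt(2) image_insert image_image using win[of "l - 1"] assms
      by (simp add: image_image cong: image_cong_simp)
  qed
  ultimately show "edges (ladder i l) = ?e ` {..<2 * l}"
    unfolding split image_Un ladder_def by auto
qed (use assms in auto)

lemma subgraph_ladder:
  assumes "2 \<le> l" "l \<le> m"
  shows "subgraph (ladder i l) P"
proof (rule subgraph_P)
  show "e \<subseteq> verts (ladder i l)" if "e \<in> edges (ladder i l)" for e
    using that cycle_graph_verts[OF cycle_graph_ladder[OF assms]] by auto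
qed (auto simp: ladder_def verts_P edges_P)

lemma uu_in_ladder:
  "uu j \<in> edges (ladder i l) \<longleftrightarrow> (\<exists>t<l - 1. j mod m = (i + t) mod m)"
proof -
  have "uu j \<in> edges (ladder i l) \<longleftrightarrow> (\<exists>x\<in>{i..<i + l - 1}. j mod m = x mod m)"
    unfolding ladder_def by (simp add: edge_kinds_neq image_iff uu_eq_iff)
  also have "\<dots> \<longleftrightarrow> (\<exists>t<l - 1. j mod m = (i + t) mod m)"
  proof safe
    fix x assume "x \<in> {i..<i + l - 1}" "j mod m = x mod m"
    then show "\<exists>t<l - 1. j mod m = (i + t) mod m" by (intro exI[of _ "x - i"]) auto
  next
    fix t assume "t < l - 1" "j mod m = (i + t) mod m"
    then show "\<exists>x\<in>{i..<i + l - 1}. j mod m = x mod m" by (intro bexI[of _ "i + t"]) auto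
  qed
  finally show ?thesis .
qed

text \<open>The first rung of a ladder is recovered as the place where the \<open>u\<close>-edges start.\<close>

lemma inj_on_ladder:
  assumes "2 \<le> l" "l \<le> m"
  shows "inj_on (\<lambda>i. ladder i l) {..<m}"
proof (rule inj_onI)
  fix i j assume i: "i \<in> {..<m}" and j: "j \<in> {..<m}" and eq: "ladder i l = ladder j l"
  have "uu i \<in> edges (ladder j l)"
    using assms eq uu_in_ladder[of i i l] by force
  then obtain t where t: "t < l - 1" "i mod m = (j + t) mod m"
    by (auto simp: uu_in_ladder)
  \<comment> \<open>If edge \<open>i\<close> were not the first \<open>u\<close>-edge of the ladder
    at \<open>j\<close>, its predecessor would belong to the ladder at \<open>i\<close> too, at some
    offset \<open>r\<close>. Then \<open>i\<close> and \<open>i + Suc r\<close> would be congruent,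
    but \<open>Suc r < m\<close> because a ladder has at most \<open>m - 1\<close>
    \<open>u\<close>-edges.\<close>
  have t0: "t = 0"
  proof (rule ccontr)
    assume "t \<noteq> 0"
    then obtain s where s: "t = Suc s" by (cases t) auto
    have "uu (j + s) \<in> edges (ladder i l)"
      unfolding eq uu_in_ladder using t s by (intro exI[of _ s]) auto
    then obtain r where r: "r < l - 1" "(j + s) mod m = (i + r) mod m"
      by (auto simp: uu_in_ladder)
    then have "Suc (j + s) mod m = Suc (i + r) mod m"
      using mod_Suc_cancel by blast
    with t s have "i mod m = (i + Suc r) mod m" by simp
    moreover have "Suc r < m" using r assms by linarith
    ultimately show False using mod_add_neq[of "Suc r" m i] by simp
  qed
  with t i j show "i = j" by auto
qed

lemma cycle_graph_rims:
  "cycle_graph m (range u, range uu)" "subgraph (range u, range uu) P"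
  "cycle_graph m (range v, range vv)" "subgraph (range v, range vv) P"
proof -
  show "cycle_graph m (range u, range uu)" "cycle_graph m (range v, range vv)"
    using cycle_graph_cyclicI[OF m3 cyclic_u] cycle_graph_cyclicI[OF m3 cyclic_v] by auto
  show "subgraph (range u, range uu) P" "subgraph (range v, range vv) P"
    by (rule subgraph_P; auto simp: verts_P edges_P)+
qed

end

section \<open>Classification of the cycles by their edge indicators\<close>

locale prism_cycle = prism +
  fixes k :: nat and C :: "gp_vertex ugraph"
  assumes sub: "subgraph C P" and cyc: "cycle_graph k C"
begin

definition a :: "nat \<Rightarrow> bool" where "a j \<longleftrightarrow> uu j \<in> edges C"
definition b :: "nat \<Rightarrow> bool" where "b j \<longleftrightarrow> vv j \<in> edges C"
definition r :: "nat \<Rightarrow> bool" where "r j \<longleftrightarrow> uv j \<in> edges C"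

lemma periodic:
  assumes "i mod m = j mod m"
  shows "a i = a j" "b i = b j" "r i = r j"
  using assms uu_eq_iff[of i j] vv_eq_iff[of i j] uv_eq_iff[of i j]
  unfolding a_def b_def r_def by metis+

lemma edges_subset: "edges C \<subseteq> range uu \<union> range vv \<union> range uv"
  using sub edges_P by (auto simp: subgraph_def)

lemma edges_C: "edges C = uu ` {j. a j} \<union> vv ` {j. b j} \<union> uv ` {j. r j}"
proof (intro equalityI subsetI)
  fix e assume e: "e \<in> edges C"
  then consider j where "e = uu j" | j where "e = vv j" | j where "e = uv j"
    using edges_subset by blast
  then show "e \<in> uu ` {j. a j} \<union> vv ` {j. b j} \<union> uv ` {j. r j}"
    by cases (use e in \<open>auto simp: a_def b_def r_def\<close>)
qed (auto simp: a_def b_def r_def)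

text \<open>One representative per residue class makes the three index maps injective, so edges can
  be counted by indices.\<close>

lemma edges_C_window:
  "edges C = uu ` {j. j < m \<and> a j} \<union> vv ` {j. j < m \<and> b j} \<union> uv ` {j. j < m \<and> r j}"
proof -
  have *: "f ` {j. p j} = f ` {j. j < m \<and> p j}"
    if "\<And>j. f (j mod m) = f j" "\<And>j. p (j mod m) = p j" for f :: "nat \<Rightarrow> 'x" and p
  proof -
    have "f j \<in> f ` {j. j < m \<and> p j}" if "p j" for j
      using that m3 \<open>\<And>j. f (j mod m) = f j\<close>[of j] \<open>\<And>j. p (j mod m) = p j\<close>[of j]
      by (intro image_eqI[of _ _ "j mod m"]) auto
    then show ?thesis by auto
  qed
  have "uu ` {j. a j} = uu ` {j. j < m \<and> a j}"
    by (rule *) (simp_all only: uu_eq_iff mod_mod_trivial periodic(1)[of "_ mod m"])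
  moreover have "vv ` {j. b j} = vv ` {j. j < m \<and> b j}"
    by (rule *) (simp_all only: vv_eq_iff mod_mod_trivial periodic(2)[of "_ mod m"])
  moreover have "uv ` {j. r j} = uv ` {j. j < m \<and> r j}"
    by (rule *) (simp_all only: uv_eq_iff mod_mod_trivial periodic(3)[of "_ mod m"])
  ultimately show ?thesis using edges_C by simp
qed

text \<open>The prism is cubic. Writing the incident edges as an intersection with three candidates
  turns the degree condition into one on three truth values.\<close>

lemma incident_u: "{e \<in> edges C. u (Suc j) \<in> e} = edges C \<inter> {uu j, uu (Suc j), uv (Suc j)}"
proof -
  have "e \<in> {uu j, uu (Suc j), uv (Suc j)}"
    if e: "e \<in> edges C" "u (Suc j) \<in> e" for e
  proof -
    from e(1) edges_subset consider i where "e = vv i" | i where "e = uu i" | i where "e = uv i"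
      by blast
    then show ?thesis
    proof cases
      case 1
      with e(2) show ?thesis by (simp add: u_neq_v)
    next
      case (2 i)
      with e(2) have "j mod m = i mod m \<or> Suc j mod m = i mod m"
        by (auto simp: u_eq_iff mod_Suc_cancel)
      then have "e = uu j \<or> e = uu (Suc j)"
        unfolding 2 uu_eq_iff by auto
      then show ?thesis by (simp only: insert_iff) blast
    next
      case (3 i)
      with e(2) have "Suc j mod m = i mod m"
        by (auto simp: u_eq_iff u_neq_v)
      then have "e = uv (Suc j)"
        unfolding 3 uv_eq_iff by simp
      then show ?thesis by simp
    qed
  qed
  then show ?thesis
    by (intro equalityI subsetI IntI CollectI conjI; (elim IntE CollectE conjE)?; force)
qed

lemma incident_v: "{e \<in> edges C. v (Suc j) \<in> e} = edges C \<inter> {vv j, vv (Suc j), uv (Suc j)}"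
proof -
  have "e \<in> {vv j, vv (Suc j), uv (Suc j)}"
    if e: "e \<in> edges C" "v (Suc j) \<in> e" for e
  proof -
    from e(1) edges_subset consider i where "e = uu i" | i where "e = vv i" | i where "e = uv i"
      by blast
    then show ?thesis
    proof cases
      case 1
      with e(2) show ?thesis by (simp add: u_neq_v)
    next
      case (2 i)
      with e(2) have "j mod m = i mod m \<or> Suc j mod m = i mod m"
        by (auto simp: v_eq_iff mod_Suc_cancel)
      then have "e = vv j \<or> e = vv (Suc j)"
        unfolding 2 vv_eq_iff by auto
      then show ?thesis by (simp only: insert_iff) blast
    next
      case (3 i)
      with e(2) have "Suc j mod m = i mod m"
        by (auto simp: v_eq_iff u_neq_v)
      then have "e = uv (Suc j)"
        unfolding 3 uv_eq_iff by simp
      then show ?thesis by simp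
    qed
  qed
  then show ?thesis
    by (intro equalityI subsetI IntI CollectI conjI; (elim IntE CollectE conjE)?; force)
qed

text \<open>An even number of the three distinct edges at a vertex lies in \<open>C\<close>, so the
  rung is used exactly when one of the two rim edges is. This is applied at both ends of the
  rung.\<close>

lemma r_Suc: "r (Suc j) \<longleftrightarrow> a j \<noteq> a (Suc j)" "r (Suc j) \<longleftrightarrow> b j \<noteq> b (Suc j)"
proof -
  have *: "z \<in> E \<longleftrightarrow> (x \<in> E) \<noteq> (y \<in> E)"
    if "card (E \<inter> {x, y, z}) = 0 \<or> card (E \<inter> {x, y, z}) = 2" "x \<noteq> y" "x \<noteq> z" "y \<noteq> z"
    for x y z :: "gp_vertex set" and E
    using that by (cases "x \<in> E"; cases "y \<in> E"; cases "z \<in> E") auto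
  have j: "j mod m \<noteq> Suc j mod m"
    using mod_add_neq[of 1 m j] m3 by auto
  have "uu j \<noteq> uu (Suc j)" "vv j \<noteq> vv (Suc j)"
    using j uu_eq_iff[of j "Suc j"] vv_eq_iff[of j "Suc j"] by blast+
  then show "r (Suc j) \<longleftrightarrow> a j \<noteq> a (Suc j)" "r (Suc j) \<longleftrightarrow> b j \<noteq> b (Suc j)"
    unfolding a_def b_def r_def
    using cycle_graph_degree[OF cyc, of "u (Suc j)"] cycle_graph_degree[OF cyc, of "v (Suc j)"]
    by (intro *; simp only: incident_u incident_v edge_kinds_neq simp_thms)+
qed

text \<open>Both indicators change at the same places, namely at the rungs used.\<close>

lemma a_eq_b_iff: "(a j = b j) = (a 0 = b 0)"
proof (induction j)
  case (Suc j)
  then show ?case using r_Suc[of j] by blast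
qed simp

lemma edges_nonempty: "edges C \<noteq> {}"
  using cycle_graph_card_edges[OF cyc] cyc by (auto simp: cycle_graph_def)

text \<open>Every position carries exactly one of its two rim edges, which accounts for
  \<open>m\<close>. The rungs mark the changes of \<open>a\<close> around a closed circle, and these
  are even in number.\<close>

lemma winding_length:
  assumes "a 0 \<noteq> b 0"
  shows "k = m + card {j. j < m \<and> r j}" "even (card {j. j < m \<and> r j})"
proof -
  have inj: "inj_on uu A" "inj_on vv A" "inj_on uv A" if "A \<subseteq> {..<m}" for A
    using that unfolding inj_on_def uu_eq_iff vv_eq_iff uv_eq_iff
    by (metis lessThan_iff mod_less subsetD)+
  have b: "b j \<longleftrightarrow> \<not> a j" for j using assms a_eq_b_iff[of j] by blast
  have "k = card (uu ` {j. j < m \<and> a j}) + card (vv ` {j. j < m \<and> b j})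
      + card (uv ` {j. j < m \<and> r j})"
  proof -
    have "uu ` X \<inter> vv ` Y = {}" "uu ` X \<inter> uv ` Y = {}" "vv ` X \<inter> uv ` Y = {}" for X Y
      using edge_kinds_neq by blast+
    then show ?thesis
      unfolding cycle_graph_card_edges[OF cyc, symmetric] edges_C_window
      by (simp add: card_Un_disjoint Int_Un_distrib2)
  qed
  also have "\<dots> = card {j. j < m \<and> a j} + card {j. j < m \<and> b j} + card {j. j < m \<and> r j}"
    by (simp add: card_image inj subset_iff)
  also have "card {j. j < m \<and> a j} + card {j. j < m \<and> b j} = card ({j. j < m \<and> a j} \<union> {j. j < m \<and> b j})"
    by (subst card_Un_disjoint) (auto simp: b)
  also have "{j. j < m \<and> a j} \<union> {j. j < m \<and> b j} = {..<m}"
    by (auto simp: b)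
  finally show "k = m + card {j. j < m \<and> r j}" by simp
  have "card {j. j < m \<and> r j} = (\<Sum>j<m. of_bool (r j))"
    by (simp add: of_bool_def sum.If_cases Int_def)
  \<comment> \<open>The window is shifted by one, which is harmless since \<open>r m = r 0\<close>;
    now each summand is a change of \<open>a\<close>.\<close>
  also have "\<dots> = (\<Sum>j<m. of_bool (r (Suc j)))"
    using sum.lessThan_Suc_shift[of "\<lambda>j. of_bool (r j) :: nat" m] periodic(3)[of m 0]
    by simp
  also have "\<dots> = (\<Sum>j<m. of_bool (a j \<noteq> a (Suc j)))"
    by (simp add: r_Suc(1))
  finally show "even (card {j. j < m \<and> r j})"
    using even_card_changes[of a m] periodic(1)[of m 0] by simp
qed

text \<open>Length \<open>m\<close> leaves no room for rungs, so \<open>a\<close> never changes and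
  the cycle stays on one side.\<close>

lemma rim:
  assumes "a 0 \<noteq> b 0" "k = m"
  shows "C = (range u, range uu) \<or> C = (range v, range vv)"
proof -
  have "\<not> r (j mod m)" for j
    using winding_length[OF assms(1)] assms(2) m3 by (auto simp: card_eq_0_iff)
  then have r: "\<not> r j" for j using periodic(3)[of "j mod m" j] by simp
  have a: "a j = a 0" for j
    by (induction j) (use r r_Suc in auto)
  then have b: "b j \<longleftrightarrow> \<not> a 0" for j using assms a_eq_b_iff[of j] by blast
  have "edges C = (if a 0 then range uu else range vv)"
    unfolding edges_C using r a b by auto
  then have "C = (\<Union> (range uu), range uu) \<or> C = (\<Union> (range vv), range vv)"
    using cycle_graph_verts[OF cyc] by (cases C) (auto split: if_splits)
  moreover have "\<Union> (range uu) = range u" "\<Union> (range vv) = range v" by auto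
  ultimately show ?thesis by simp
qed

text \<open>With \<open>a\<close> and \<open>b\<close> equal, a maximal run of positions carrying
  rim edges spans a strip that no edge of \<open>C\<close> leaves. By connectedness this strip
  contains all of \<open>C\<close>, and rungs occur only where the run begins or ends.\<close>

lemma contractible_ladder:
  assumes "a 0 = b 0"
  shows "\<exists>i l. 2 \<le> l \<and> l \<le> m \<and> C = ladder i l"
proof -
  have b: "b j = a j" for j using assms a_eq_b_iff[of j] by blast
  have "\<exists>j. a j"
  proof (rule ccontr)
    assume *: "\<nexists>j. a j"
    then have "\<not> r j" for j using Suc_surj_mod[of j] periodic(3) r_Suc by metis
    with * b edges_nonempty show False unfolding edges_C by auto
  qed
  then obtain j where j: "a j" ..
  \<comment> \<open>Otherwise \<open>C\<close> would consist of both full rims without any rung,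
    which is disconnected.\<close>
  have "\<exists>i. \<not> a i"
  proof (rule ccontr)
    assume *: "\<nexists>j. \<not> a j"
    then have r: "\<not> r j" for j using Suc_surj_mod[of j] periodic(3) r_Suc by metis
    have C: "edges C = range uu \<union> range vv" unfolding edges_C using * b r by auto
    then have "verts C = range u \<union> range v" using cycle_graph_verts[OF cyc] by auto
    moreover have "verts C \<subseteq> range u"
      by (rule cycle_graph_connected[OF cyc, of "u 0"])
         (use C calculation in \<open>auto simp: u_neq_v\<close>)
    ultimately show False using u_neq_v by blast
  qed
  then obtain i0 where "\<not> a i0" ..
  have "\<exists>i. \<not> a i \<and> a (Suc i)"
  proof (rule ccontr)
    assume *: "\<nexists>i. \<not> a i \<and> a (Suc i)"
    have "\<not> a (i0 + t)" for t
      by (induction t) (use * \<open>\<not> a i0\<close> in auto)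
    \<comment> \<open>Adding \<open>i0 * m\<close> keeps the residue of \<open>j\<close> and makes
      the index at least \<open>i0\<close>, so it is reached from \<open>i0\<close>.\<close>
    from this[of "j + i0 * m - i0"] have "\<not> a (j + i0 * m)"
      using m3 by (simp add: trans_le_add2)
    with j periodic(1)[of "j + i0 * m" j] show False by simp
  qed
  then obtain i where i: "\<not> a i" "a (Suc i)" by blast
  define h where "h = Suc i"
  \<comment> \<open>The index \<open>h + (m - 1)\<close> is \<open>i + m\<close>, one turn after the
    gap before the run. Hence the run has length at most \<open>m - 1\<close>, and the ladder at
    most \<open>m\<close> rungs.\<close>
  have end_ex: "\<not> a (h + (m - 1))"
    using i periodic(1)[of "i + m" i] m3 by (simp add: h_def)
  define s where "s = (LEAST s. \<not> a (h + s))"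
  have s_end: "\<not> a (h + s)" unfolding s_def by (rule LeastI[of _ "m - 1"]) (rule end_ex)
  have s_le: "s \<le> m - 1" unfolding s_def by (rule Least_le) (rule end_ex)
  have run: "a (h + t)" if "t < s" for t
    using that not_less_Least unfolding s_def by blast
  have s_pos: "0 < s" using s_end i by (cases s) (auto simp: h_def)
  \<comment> \<open>The run of \<open>s\<close> rim edges touches \<open>s + 1\<close> columns,
    hence the closed interval.\<close>
  define S where "S = u ` {h..h + s} \<union> v ` {h..h + s}"
  have inS: "u x \<in> S \<longleftrightarrow> (\<exists>t\<le>s. x mod m = (h + t) mod m)"
      "v x \<in> S \<longleftrightarrow> (\<exists>t\<le>s. x mod m = (h + t) mod m)" for x
  proof -
    have "(\<exists>y\<in>{h..h + s}. x mod m = y mod m) \<longleftrightarrow> (\<exists>t\<le>s. x mod m = (h + t) mod m)"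
      by (auto intro: bexI[of _ "h + _"]) (metis add_le_cancel_left le_add_diff_inverse)
    then show "u x \<in> S \<longleftrightarrow> (\<exists>t\<le>s. x mod m = (h + t) mod m)"
      "v x \<in> S \<longleftrightarrow> (\<exists>t\<le>s. x mod m = (h + t) mod m)"
      by (auto simp: S_def image_iff u_eq_iff v_eq_iff u_neq_v)
  qed
  \<comment> \<open>A rim edge of \<open>C\<close> starting in a column of the strip does not start
    in the last one, because \<open>a (h + s)\<close> fails.\<close>
  have step_up: "\<exists>t<s. x mod m = (h + t) mod m"
    if "a x" "\<exists>t\<le>s. x mod m = (h + t) mod m" for x
    using that s_end periodic(1) by (metis le_neq_implies_less)
  \<comment> \<open>A rim edge of \<open>C\<close> ending in a column of the strip does not end in
    the first one, because it would be the edge at \<open>i\<close>, where \<open>a\<close>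
    fails.\<close>
  have step_down: "\<exists>t<s. x mod m = (h + t) mod m"
    if "a x" "\<exists>t\<le>s. Suc x mod m = (h + t) mod m" for x
  proof -
    from that(2) obtain t where t: "t \<le> s" "Suc x mod m = (h + t) mod m" by blast
    then have "x mod m = (i + t) mod m" using mod_Suc_cancel[of x m "i + t"] by (simp add: h_def)
    with that(1) i(1) periodic(1)[of x "i + t"] t obtain t' where "t = Suc t'"
      by (cases t) auto
    with t \<open>x mod m = (i + t) mod m\<close> show ?thesis by (intro exI[of _ t']) (auto simp: h_def)
  qed
  have next_ex: "\<exists>t\<le>s. Suc x mod m = (h + t) mod m"
    if "\<exists>t<s. x mod m = (h + t) mod m" for x
    using that by (metis Suc_leI add_Suc_right mod_Suc_cancel)
  have both: "(\<exists>t\<le>s. x mod m = (h + t) mod m) \<and> (\<exists>t\<le>s. Suc x mod m = (h + t) mod m)"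
    if "a x" "(\<exists>t\<le>s. x mod m = (h + t) mod m) \<or> (\<exists>t\<le>s. Suc x mod m = (h + t) mod m)" for x
    using that step_up[of x] step_down[of x] next_ex[of x] by (meson less_imp_le)
  have "uu h \<in> edges C" using i by (simp add: a_def h_def)
  then have "u h \<in> verts C" using cycle_graph_verts[OF cyc] by auto
  then have vC: "verts C \<subseteq> S"
  proof (rule cycle_graph_connected[OF cyc])
    show "u h \<in> S" by (auto simp: S_def)
    fix e assume "e \<in> edges C" "e \<inter> S \<noteq> {}"
    from \<open>e \<in> edges C\<close> consider x where "e = uu x" "a x" | x where "e = vv x" "a x" | x where "e = uv x"
      unfolding edges_C b by blast
    then show "e \<subseteq> S"
      by cases (use \<open>e \<inter> S \<noteq> {}\<close> both in \<open>auto simp: inS\<close>)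
  qed
  have a_iff: "a x \<longleftrightarrow> (\<exists>t<s. x mod m = (h + t) mod m)" for x
  proof
    assume "a x"
    then have "u x \<in> verts C" using cycle_graph_verts[OF cyc] by (auto simp: a_def)
    with vC \<open>a x\<close> step_up show "\<exists>t<s. x mod m = (h + t) mod m" by (auto simp: inS)
  qed (use run periodic(1) in metis)
  have eq_a: "f ` {x. a x} = f ` {h..<h + s}" if "\<And>x y. x mod m = y mod m \<Longrightarrow> f x = f y"
    for f :: "nat \<Rightarrow> 'x"
  proof (intro equalityI subsetI)
    fix z assume "z \<in> f ` {x. a x}"
    then obtain x t where "z = f x" "t < s" "x mod m = (h + t) mod m" using a_iff by auto
    then show "z \<in> f ` {h..<h + s}" using that[of x "h + t"] by auto
  next
    fix z assume "z \<in> f ` {h..<h + s}"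
    then obtain x where "z = f x" "h \<le> x" "x < h + s" by auto
    then show "z \<in> f ` {x. a x}" using run[of "x - h"] by auto
  qed
  \<comment> \<open>A rung at \<open>Suc y\<close> means that \<open>a\<close> changes there: a
    change from true to false happens only at the end of the run, one from false to true only at its
    start.\<close>
  have rS: "r x \<longleftrightarrow> x mod m = h mod m \<or> x mod m = (h + s) mod m" for x
  proof -
    obtain y where y: "x mod m = Suc y mod m" using Suc_surj_mod by blast
    have 1: "r h" using r_Suc(1)[of i] i by (simp add: h_def)
    have 2: "r (h + s)" using r_Suc(1)[of "h + (s - 1)"] run[of "s - 1"] s_end s_pos by simp
    have "x mod m = h mod m \<or> x mod m = (h + s) mod m" if "r x"
    proof (cases "a y")
      case True
      then obtain t where t: "t < s" "y mod m = (h + t) mod m" using a_iff by auto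
      have "\<not> a (Suc y)" using that True r_Suc(1)[of y] periodic(3)[OF y] by simp
      moreover have y': "Suc y mod m = (h + Suc t) mod m"
        using t mod_Suc_cancel[of y m "h + t"] by simp
      ultimately have "\<not> a (h + Suc t)" using periodic(1)[OF y'] by simp
      with run t have "Suc t = s" by (metis Suc_lessI)
      with y y' show ?thesis by simp
    next
      case False
      then have "a (Suc y)" using that r_Suc(1)[of y] periodic(3)[OF y] by simp
      then obtain t where t: "t < s" "Suc y mod m = (h + t) mod m" using a_iff by auto
      have "t = 0"
      proof (rule ccontr)
        assume "t \<noteq> 0"
        then obtain t' where "t = Suc t'" by (cases t) auto
        with t have "y mod m = (h + t') mod m" "t' < s" using mod_Suc_cancel[of y m "h + t'"] by auto
        with False a_iff show False by blast
      qed
      with t y show ?thesis by simp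
    qed
    with 1 2 periodic(3) show ?thesis by blast
  qed
  have eq_r: "uv ` {x. r x} = {uv h, uv (h + s)}"
  proof (intro equalityI subsetI)
    fix z assume "z \<in> uv ` {x. r x}"
    then obtain x where "z = uv x" "r x" by auto
    then show "z \<in> {uv h, uv (h + s)}"
      using rS[of x] uv_eq_iff[of x h] uv_eq_iff[of x "h + s"] by blast
  qed (use rS in auto)
  have "edges C = edges (ladder h (Suc s))"
    unfolding edges_C ladder_def b
    using eq_r eq_a[of uu] eq_a[of vv] uu_eq_iff vv_eq_iff by simp
  moreover have l: "2 \<le> Suc s" "Suc s \<le> m" using s_pos s_le m3 by auto
  ultimately have "C = ladder h (Suc s)"
    using cycle_graph_verts[OF cyc] cycle_graph_verts[OF cycle_graph_ladder[OF l, of h]]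
    by (simp add: prod_eq_iff)
  with l show ?thesis by blast
qed

end

section \<open>Counting for odd \<open>m\<close>\<close>

lemma (in prism) even_cycles:
  assumes "odd m" "2 \<le> l" "l \<le> m"
  shows "{C. subgraph C P \<and> cycle_graph (2 * l) C} = (\<lambda>i. ladder i l) ` {..<m}"
proof (intro equalityI subsetI)
  fix C assume "C \<in> {C. subgraph C P \<and> cycle_graph (2 * l) C}"
  then interpret prism_cycle m "2 * l" C
    by unfold_locales auto
  \<comment> \<open>A winding cycle has length \<open>m\<close> plus an even number, which is odd
    and so differs from \<open>2 * l\<close>.\<close>
  have "a 0 = b 0"
  proof (rule ccontr)
    assume "a 0 \<noteq> b 0"
    from winding_length[OF this] assms(1) show False
      by (metis dvd_triv_left even_add)
  qed
  then obtain i l' where "2 \<le> l'" "l' \<le> m" and C: "C = ladder i l'"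
    using contractible_ladder by blast
  then have "2 * l' = 2 * l"
    using cycle_graph_card_edges[OF cycle_graph_ladder] cycle_graph_card_edges[OF cyc] by metis
  with C have "C = ladder (i mod m) l" using assms by (simp add: ladder_mod)
  then show "C \<in> (\<lambda>i. ladder i l) ` {..<m}" using m3 by auto
qed (use assms cycle_graph_ladder subgraph_ladder in auto)

text \<open>Ladders have even length, so a cycle of odd length \<open>m\<close> must wind around the
  prism, and this length forces it to be a rim.\<close>

lemma (in prism) rim_cycles:
  assumes "odd m"
  shows "{C. subgraph C P \<and> cycle_graph m C} = {(range u, range uu), (range v, range vv)}"
proof (intro equalityI subsetI)
  fix C assume "C \<in> {C. subgraph C P \<and> cycle_graph m C}"
  then interpret prism_cycle m m C
    by unfold_locales auto
  have "a 0 \<noteq> b 0"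
  proof
    assume "a 0 = b 0"
    then obtain i l where "2 \<le> l" "l \<le> m" "C = ladder i l"
      using contractible_ladder by blast
    then have "m = 2 * l"
      using cycle_graph_card_edges[OF cycle_graph_ladder] cycle_graph_card_edges[OF cyc] by metis
    with assms show False by simp
  qed
  from rim[OF this] show "C \<in> {(range u, range uu), (range v, range vv)}" by simp
qed (use cycle_graph_rims in auto)

theorem theorem4:
  fixes n :: nat
  assumes "n \<ge> 1"
  shows "(\<forall>l. 2 \<le> l \<and> l \<le> 2 * n + 1 \<longrightarrow>
            num_cycles (gen_petersen (2 * n + 1) 1) (2 * l) = 2 * n + 1) \<and>
         num_cycles (gen_petersen (2 * n + 1) 1) (2 * n + 1) = 2"
proof -
  interpret prism "2 * n + 1"
    using assms by unfold_locales simp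
  have "num_cycles (gen_petersen (2 * n + 1) 1) (2 * l) = 2 * n + 1" if "2 \<le> l" "l \<le> 2 * n + 1" for l
    unfolding num_cycles_def P_def[symmetric] using that
    by (subst even_cycles) (simp_all add: card_image inj_on_ladder del: One_nat_def)
  \<comment> \<open>The two rims already differ in their vertices, so they count as two
    cycles.\<close>
  moreover have "range u \<noteq> range v"
    using u_neq_v by (metis rangeE rangeI)
  then have "num_cycles (gen_petersen (2 * n + 1) 1) (2 * n + 1) = 2"
    unfolding num_cycles_def P_def[symmetric] by (subst rim_cycles) auto
  ultimately show ?thesis by blast
qed

end
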